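(* Let $\|\cdot\|$ be a norm on $\mathbb{R}^2$. Let $n\ge 3$ be an odd integer and let $v_1,v_2,\ldots,v_n\in\mathbb{R}^2$ be vectors, not necessarily distinct, with $\|v_i\|=1$ for every $i\in\{1,\ldots,n\}$. If $\|v_i+v_j+v_k\|\ge 1$ for all pairwise distinct indices $i,j,k\in\{1,\ldots,n\}$, then $$\|v_1+v_2+\cdots+v_n\|\ge 1.$$
   Context: The norm $\|\cdot\|$ on $\mathbb{R}^2$ is arbitrary (not necessarily Euclidean or strictly convex). The family $v_1,\ldots,v_n$ is regarded as a sequence (multiset): $v_i=v_j$ is allowed for $i\ne j$. *)

theory Defs
  imports "HOL-Analysis.Analysis"
begin

text \<open>The library's \<open>norm\<close> on \<open>real ^ 2\<close> is the fixed Euclidean one, so an arbitrary norm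
  is modelled as a function satisfying the norm axioms.\<close>

definition is_norm :: "('a::real_vector \<Rightarrow> real) \<Rightarrow> bool" where
  "is_norm N \<longleftrightarrow>
     (\<forall>x. 0 \<le> N x) \<and>
     (\<forall>x. N x = 0 \<longleftrightarrow> x = 0) \<and>
     (\<forall>c x. N (c *\<^sub>R x) = \<bar>c\<bar> * N x) \<and>
     (\<forall>x y. N (x + y) \<le> N x + N y)"

end

theory Submission
  imports Defs
begin

text \<open>
  Everything rests on functionals \<open>f\<close> that support the unit ball at a unit vector: they are
  bounded by the norm, so \<open>f (\<Sum> v\<^sub>i) \<ge> 1\<close> or \<open>f (\<Sum> v\<^sub>i) \<le> -1\<close> is enough. An antipodal pair
  contributes nothing to the sum and can be discarded (\<open>n\<close> stays odd), so suppose that there is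
  none. Two cases remain.

  If \<open>0\<close> is outside the convex hull of the vectors, they lie in an open half-plane and are ordered
  by angle. Let \<open>m\<close> be the median one and let \<open>f\<close> support the ball at \<open>m\<close>. The other vectors split
  into pairs having \<open>m\<close> between them, and on every such pair \<open>f\<close> is nonnegative in total
  (\<open>support_at_between_nonneg\<close>). Hence \<open>f (\<Sum> v\<^sub>i) \<ge> f m = 1\<close>.

  If \<open>0\<close> is in the convex hull, Caratheodory gives three of the vectors with a positive
  dependence. Cancelling the largest coefficient shows that their sum has norm at most \<open>1\<close>, and the
  hypothesis forces equality: one vector \<open>u\<close> is such that \<open>-u\<close> lies inside the segment between the
  other two, \<open>v\<close> and \<open>w\<close>, and this segment lies on the unit sphere (\<open>positive_dependence\<close>). The
  functional \<open>f\<close> supporting the ball along this segment has \<open>f v = f w = 1\<close> and \<open>f u = -1\<close>. Any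
  further vector \<open>x\<close> is positively dependent with two of \<open>u, v, w\<close>, and the same rigidity applied
  to that triple gives \<open>f x = 1\<close> or \<open>f x = -1\<close> (\<open>level_of_other_vector\<close>). So \<open>f (\<Sum> v\<^sub>i)\<close> is
  a sum of an odd number of signs, an odd integer.
\<close>

section \<open>Sums over families of odd size\<close>

text \<open>This is the pairing around a median: removing a smallest and a largest element of the family
  leaves its median unchanged, and these two form a pair with the median between them.\<close>

lemma median_pairing:
  fixes k :: "'i \<Rightarrow> real"
  assumes "finite A" "odd (card A)"
  shows "\<exists>m\<in>A. \<forall>g :: 'i \<Rightarrow> real.
           (\<forall>a\<in>A. \<forall>b\<in>A. k a \<le> k m \<longrightarrow> k m \<le> k b \<longrightarrow> 0 \<le> g a + g b) \<longrightarrow> 0 \<le> sum g (A - {m})"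
  using assms
proof (induction "card A" arbitrary: A rule: less_induct)
  case less
  show ?case
  proof (cases "card A = 1")
    case True
    then obtain m where "A = {m}" by (auto simp: card_1_singleton_iff)
    then show ?thesis by auto
  next
    case False
    have ne: "A \<noteq> {}" using less.prems by auto
    obtain a where a: "a \<in> A" "\<And>x. x \<in> A \<Longrightarrow> k a \<le> k x"
      using ex_is_arg_min_if_finite[OF less.prems(1) ne, of k]
      by (auto simp: is_arg_min_linorder)
    have "card (A - {a}) = card A - 1" using a less.prems by simp
    moreover have "card A \<noteq> 0" using less.prems by auto
    ultimately have "A - {a} \<noteq> {}" using False
      by (metis One_nat_def card.empty diff_is_0_eq le_antisym less_one linorder_not_less)
    then obtain b where b: "b \<in> A - {a}" "\<And>x. x \<in> A - {a} \<Longrightarrow> k x \<le> k b"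
      using ex_is_arg_min_if_finite[of "A - {a}" "\<lambda>x. - k x"] less.prems(1)
      by (auto simp: is_arg_min_linorder)
    define B where "B = A - {a} - {b}"
    have A: "A = insert a (insert b B)" "a \<notin> B" "b \<notin> B" "a \<noteq> b" "finite B"
      using a b less.prems by (auto simp: B_def)
    then have "card A = Suc (Suc (card B))" by simp
    then have "card B < card A" "odd (card B)" using less.prems by auto
    then obtain m where m: "m \<in> B"
      and sumB: "\<And>g :: 'i \<Rightarrow> real.
        (\<forall>a\<in>B. \<forall>b\<in>B. k a \<le> k m \<longrightarrow> k m \<le> k b \<longrightarrow> 0 \<le> g a + g b) \<Longrightarrow> 0 \<le> sum g (B - {m})"
      using less.hyps[of B] A(5) by blast
    have "0 \<le> sum g (A - {m})"
      if g: "\<forall>a\<in>A. \<forall>b\<in>A. k a \<le> k m \<longrightarrow> k m \<le> k b \<longrightarrow> 0 \<le> g a + g b" for g :: "'i \<Rightarrow> real"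
    proof -
      have "A - {m} = insert a (insert b (B - {m}))" using A m by auto
      then have "sum g (A - {m}) = g a + g b + sum g (B - {m})" using A by simp
      moreover have "0 \<le> g a + g b" using g[rule_format, of a b] a b m by (auto simp: B_def)
      moreover have "0 \<le> sum g (B - {m})" using sumB g A by auto
      ultimately show ?thesis by linarith
    qed
    then show ?thesis using m A by auto
  qed
qed

lemma abs_sum_signs_ge_1:
  fixes g :: "'i \<Rightarrow> real"
  assumes "finite A" "odd (card A)" "\<And>i. i \<in> A \<Longrightarrow> g i = 1 \<or> g i = -1"
  shows "\<bar>sum g A\<bar> \<ge> 1"
proof -
  have "\<exists>z::int. sum g A = of_int (2 * z + int (card A))"
    using assms(1,3)
  proof (induction A)
    case empty
    then show ?case by auto
  next
    case (insert x F)
    then obtain z :: int where z: "sum g F = of_int (2 * z + int (card F))" by auto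
    have "g x = 1 \<or> g x = -1" using insert by auto
    then show ?case
    proof
      assume "g x = 1"
      then show ?thesis using insert(1,2) z by (intro exI[of _ z]) simp
    next
      assume "g x = -1"
      then show ?thesis using insert(1,2) z by (intro exI[of _ "z - 1"]) simp
    qed
  qed
  then obtain z :: int where z: "sum g A = of_int (2 * z + int (card A))" by blast
  have "odd (2 * z + int (card A))" using assms by simp
  then have "2 * z + int (card A) \<noteq> 0" by fastforce
  then have "\<bar>2 * z + int (card A)\<bar> \<ge> 1" by linarith
  then show ?thesis unfolding z by linarith
qed

section \<open>Supporting functionals of an arbitrary norm\<close>

context
  fixes N :: "'a::euclidean_space \<Rightarrow> real"
  assumes norm_N: "is_norm N"
begin

lemma N_nonneg: "0 \<le> N x"
  and N_eq_0: "N x = 0 \<longleftrightarrow> x = 0"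
  and N_scale: "N (c *\<^sub>R x) = \<bar>c\<bar> * N x"
  and N_triangle: "N (x + y) \<le> N x + N y"
  using norm_N unfolding is_norm_def by blast+

lemma N_minus: "N (- x) = N x"
  using N_scale[of "-1" x] by simp

lemma N_comb_le: "N (a *\<^sub>R x + b *\<^sub>R y) \<le> \<bar>a\<bar> * N x + \<bar>b\<bar> * N y"
  using N_triangle[of "a *\<^sub>R x" "b *\<^sub>R y"] by (simp add: N_scale)

lemma ex_support_functional:
  assumes m: "N m = 1"
  shows "\<exists>f. inner f m = 1 \<and> (\<forall>x. \<bar>inner f x\<bar> \<le> N x)"
proof -
  define B where "B = {x. N x < 1}"
  have "convex B"
  proof (rule convexI)
    fix x y :: 'a and s t :: real
    assume xy: "x \<in> B" "y \<in> B" and st: "0 \<le> s" "0 \<le> t" "s + t = 1"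
    have "N (s *\<^sub>R x + t *\<^sub>R y) \<le> s * N x + t * N y"
      using N_comb_le[of s x t y] st by simp
    also have "\<dots> < 1" using convex_bound_lt[of "N x" 1 "N y" s t] xy st by (simp add: B_def)
    finally show "s *\<^sub>R x + t *\<^sub>R y \<in> B" by (simp add: B_def)
  qed
  moreover have "B \<noteq> {}" using N_eq_0[of 0] by (auto simp: B_def intro!: exI[of _ 0])
  moreover have "B \<inter> {m} = {}" using m by (simp add: B_def)
  ultimately obtain a b where a: "a \<noteq> 0" and below: "\<And>x. N x < 1 \<Longrightarrow> inner a x \<le> b"
    and above: "b \<le> inner a m"
    using separating_hyperplane_sets[of B "{m}"] by (auto simp: B_def)
  have bound: "inner a x \<le> b * N x" if "x \<noteq> 0" for x
  proof -
    have pos: "N x > 0" using that N_nonneg[of x] N_eq_0[of x] by linarith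
    have "t * (inner a x / N x) \<le> b" if t: "0 < t" "t < 1" for t
      using below[of "(t / N x) *\<^sub>R x"] pos t by (simp add: N_scale)
    then have "inner a x / N x \<le> b" by (rule field_le_mult_one_interval)
    then show ?thesis using pos by (simp add: field_simps)
  qed
  have "0 < b * N a" using bound[OF a] a by (smt (verit) inner_gt_zero_iff)
  then have b: "b > 0" using N_nonneg[of a] by (simp add: zero_less_mult_iff)
  have "m \<noteq> 0" using m N_eq_0[of m] by auto
  then have "inner a m = b" using bound[of m] m above by simp
  moreover have "\<bar>inner a x\<bar> \<le> b * N x" for x
    using bound[of x] bound[of "- x"] N_minus[of x] N_eq_0[of 0] by (cases "x = 0") auto
  ultimately show ?thesis using b
    by (intro exI[of _ "(1 / b) *\<^sub>R a"]) (simp add: field_simps)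
qed

text \<open>The functional is \<open>1\<close> at \<open>m\<close> and at least \<open>-1\<close> at \<open>a\<close> and \<open>b\<close>; it could be negative on
  \<open>a + b\<close> only if one coefficient of \<open>m\<close> were much larger than the other, but the triangle
  inequality lets them differ by at most \<open>1\<close>.\<close>

lemma support_at_between_nonneg:
  assumes unit: "N a = 1" "N b = 1" "N m = 1"
    and m: "m = p *\<^sub>R a + q *\<^sub>R b" "p \<ge> 0" "q \<ge> 0"
    and f: "inner f m = 1" "\<And>x. \<bar>inner f x\<bar> \<le> N x"
  shows "0 \<le> inner f a + inner f b"
proof -
  have key: "0 \<le> s + t"
    if eq: "1 = c * s + d * t" and "c \<ge> 0" "d \<ge> 0" "c \<le> 1 + d" "t \<ge> -1" "s \<ge> t" for c d s t :: real
  proof (rule ccontr)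
    assume "\<not> 0 \<le> s + t"
    then have neg: "s + t < 0" by simp
    then have "d * t \<le> 0" using that by (auto simp: mult_le_0_iff)
    have "s > 0"
    proof (rule ccontr)
      assume "\<not> s > 0"
      then have "c * s \<le> 0" using that by (auto simp: mult_le_0_iff)
      then show False using eq \<open>d * t \<le> 0\<close> by linarith
    qed
    then have "c * s \<le> (1 + d) * s" using that by (intro mult_right_mono) auto
    moreover have "d * (s + t) \<le> 0" using neg that by (auto simp: mult_le_0_iff)
    ultimately have "1 \<le> s" using eq by (simp add: algebra_simps)
    then show False using neg that by linarith
  qed
  have eq: "1 = p * inner f a + q * inner f b" using f(1) m(1) by (simp add: inner_add_right)
  have "N (p *\<^sub>R a) \<le> 1 + q"
    using N_comb_le[of 1 m "-q" b] m unit by simp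
  then have pq: "p \<le> 1 + q" using m unit by (simp add: N_scale)
  have "N (q *\<^sub>R b) \<le> 1 + p"
    using N_comb_le[of 1 m "-p" a] m unit by simp
  then have qp: "q \<le> 1 + p" using m unit by (simp add: N_scale)
  have "\<bar>inner f a\<bar> \<le> 1" "\<bar>inner f b\<bar> \<le> 1" using f(2)[of a] f(2)[of b] unit by auto
  then show ?thesis
    using key[of p "inner f a" q "inner f b"] key[of q "inner f b" p "inner f a"] eq pq qp m(2,3)
    by (cases "inner f a \<ge> inner f b") (auto simp: add.commute)
qed

end

section \<open>Rigidity of positively dependent triples\<close>

text \<open>The bounds on \<open>t\<close> are strict because only at a relative interior point of a segment does a
  supporting functional have to be constant along the segment.\<close>

definition opposite_inside :: "'a::real_vector \<Rightarrow> 'a \<Rightarrow> 'a \<Rightarrow> bool" where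
  "opposite_inside x y z \<longleftrightarrow> (\<exists>t. 0 < t \<and> t < 1 \<and> - x = t *\<^sub>R y + (1 - t) *\<^sub>R z)"

lemma opposite_inside_swap: "opposite_inside u v w \<Longrightarrow> opposite_inside u w v"
proof -
  assume "opposite_inside u v w"
  then obtain t where "0 < t" "t < 1" "- u = t *\<^sub>R v + (1 - t) *\<^sub>R w"
    unfolding opposite_inside_def by blast
  then show ?thesis unfolding opposite_inside_def by (intro exI[of _ "1 - t"]) (simp add: add.commute)
qed

context
  fixes N :: "'a::euclidean_space \<Rightarrow> real"
  assumes norm_N: "is_norm N"
begin

text \<open>With the largest coefficient normalised to \<open>1\<close>, the dependence \<open>x + by + cz = 0\<close> gives
  \<open>1 = \<parallel>x\<parallel> \<le> b + c\<close> and \<open>1 \<le> \<parallel>x + y + z\<parallel> = \<parallel>(1 - b)y + (1 - c)z\<parallel> \<le> 2 - b - c\<close>, so \<open>b + c = 1\<close>.\<close>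

lemma opposite_inside_if_largest_coeff:
  assumes unit: "N x = 1" "N y = 1" "N z = 1"
    and dep: "p *\<^sub>R x + q *\<^sub>R y + r *\<^sub>R z = 0" "p \<ge> q" "p \<ge> r" "q > 0" "r > 0"
    and sum: "N (x + y + z) \<ge> 1"
  shows "opposite_inside x y z"
proof -
  have p: "p > 0" using dep by linarith
  define b c where "b = q / p" and "c = r / p"
  have bc: "0 < b" "b \<le> 1" "0 < c" "c \<le> 1" using p dep by (auto simp: b_def c_def)
  have "x + b *\<^sub>R y + c *\<^sub>R z = (1 / p) *\<^sub>R (p *\<^sub>R x + q *\<^sub>R y + r *\<^sub>R z)"
    using p by (simp add: b_def c_def scaleR_add_right)
  then have "x + (b *\<^sub>R y + c *\<^sub>R z) = 0"
    unfolding dep(1) by (simp only: scaleR_zero_right add.assoc)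
  then have x: "- x = b *\<^sub>R y + c *\<^sub>R z" by (rule minus_unique)
  have "1 \<le> b + c"
    using N_comb_le[OF norm_N, of b y c z] unit bc N_minus[OF norm_N, of x]
    unfolding x[symmetric] by simp
  moreover have "(1 - b) *\<^sub>R y + (1 - c) *\<^sub>R z = y + z - (b *\<^sub>R y + c *\<^sub>R z)"
    by (simp add: algebra_simps)
  then have "x + y + z = (1 - b) *\<^sub>R y + (1 - c) *\<^sub>R z"
    unfolding x[symmetric] by (simp add: add_ac)
  then have "1 \<le> (1 - b) + (1 - c)" using N_comb_le[OF norm_N, of "1 - b" y "1 - c" z] unit bc sum by simp
  ultimately have "c = 1 - b" by linarith
  then show ?thesis unfolding opposite_inside_def using x bc by (intro exI[of _ b]) auto
qed

lemma antipodal_if_dependent: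
  assumes "N x = 1" "N y = 1" "p *\<^sub>R x + q *\<^sub>R y = 0" "p \<ge> 0" "q \<ge> 0" "p \<noteq> 0 \<or> q \<noteq> 0"
  shows "x = - y"
proof -
  have px: "p *\<^sub>R x = - (q *\<^sub>R y)" using assms(3) by (simp add: eq_neg_iff_add_eq_0)
  then have "N (p *\<^sub>R x) = N (q *\<^sub>R y)" by (simp add: N_minus[OF norm_N])
  then have "p = q" using assms by (simp add: N_scale[OF norm_N])
  then show ?thesis using px assms(6) by (metis scaleR_cancel_left scaleR_minus_right)
qed

lemma positive_dependence:
  assumes unit: "N x = 1" "N y = 1" "N z = 1"
    and no_antipodes: "x \<noteq> - y" "x \<noteq> - z" "y \<noteq> - z"
    and dep: "p *\<^sub>R x + q *\<^sub>R y + r *\<^sub>R z = 0" "p \<ge> 0" "q \<ge> 0" "r \<ge> 0" "p \<noteq> 0 \<or> q \<noteq> 0 \<or> r \<noteq> 0"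
    and sum: "N (x + y + z) \<ge> 1"
  shows "opposite_inside x y z \<or> opposite_inside y x z \<or> opposite_inside z x y"
proof -
  have "p \<noteq> 0" using antipodal_if_dependent[of y z q r] assms by auto
  moreover have "q \<noteq> 0" using antipodal_if_dependent[of x z p r] assms by auto
  moreover have "r \<noteq> 0" using antipodal_if_dependent[of x y p q] assms by auto
  ultimately have pos: "p > 0" "q > 0" "r > 0" using dep by auto
  have dep': "q *\<^sub>R y + p *\<^sub>R x + r *\<^sub>R z = 0" "r *\<^sub>R z + p *\<^sub>R x + q *\<^sub>R y = 0"
    and sum': "N (y + x + z) \<ge> 1" "N (z + x + y) \<ge> 1"
    using dep sum by (simp_all add: add_ac)
  consider "p \<ge> q" "p \<ge> r" | "q \<ge> p" "q \<ge> r" | "r \<ge> p" "r \<ge> q" by linarith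
  then show ?thesis
  proof cases
    case 1
    then show ?thesis using opposite_inside_if_largest_coeff[OF unit(1,2,3) dep(1)] pos sum by blast
  next
    case 2
    then show ?thesis
      using opposite_inside_if_largest_coeff[OF unit(2,1,3) dep'(1)] pos sum' by blast
  next
    case 3
    then show ?thesis
      using opposite_inside_if_largest_coeff[OF unit(3,1,2) dep'(2)] pos sum' by blast
  qed
qed

text \<open>A functional supporting the ball at a relative interior point of a segment whose ends are in
  the ball is constant on the segment.\<close>

lemma opposite_inside_support:
  assumes "opposite_inside u v w" "N u = 1" "N v = 1" "N w = 1"
  shows "\<exists>f. inner f u = -1 \<and> inner f v = 1 \<and> inner f w = 1 \<and> (\<forall>x. \<bar>inner f x\<bar> \<le> N x)"
proof -
  obtain t where t: "0 < t" "t < 1" "- u = t *\<^sub>R v + (1 - t) *\<^sub>R w"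
    using assms(1) unfolding opposite_inside_def by blast
  obtain f where f: "inner f (- u) = 1" "\<And>x. \<bar>inner f x\<bar> \<le> N x"
    using ex_support_functional[OF norm_N, of "- u"] assms N_minus[OF norm_N, of u] by auto
  have eq: "t * inner f v + (1 - t) * inner f w = 1"
    using f(1) unfolding t(3) by (simp add: inner_add_right)
  have le: "inner f v \<le> 1" "inner f w \<le> 1" using f(2)[of v] f(2)[of w] assms by auto
  have "t * (1 - inner f v) + (1 - t) * (1 - inner f w) = 0" using eq by (simp add: algebra_simps)
  moreover have "0 \<le> t * (1 - inner f v)" "0 \<le> (1 - t) * (1 - inner f w)" using le t by simp_all
  ultimately have "t * (1 - inner f v) = 0" "(1 - t) * (1 - inner f w) = 0" by linarith+
  moreover have "inner f u = -1" using f(1) by simp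
  ultimately show ?thesis using t(1,2) f(2) by (intro exI[of _ f]) auto
qed

text \<open>The rigidity of the triple \<open>x, u, v\<close> leaves three possibilities. Two of them put \<open>x\<close> on a line
  \<open>f = 1\<close> or \<open>f = -1\<close>. In the third one the segment from \<open>u\<close> to \<open>v\<close> is on the sphere; its
  supporting functional is \<open>1\<close> at \<open>v\<close> and \<open>-1\<close> at \<open>-u\<close>, so beyond \<open>-u\<close>, at \<open>w\<close>, it is less than
  \<open>-1\<close>, which is impossible.\<close>

lemma level_if_dependent_with_opposite:
  assumes unit: "N u = 1" "N v = 1" "N w = 1" "N x = 1"
    and uvw: "opposite_inside u v w"
    and f: "inner f u = -1" "inner f v = 1"
    and no_antipodes: "x \<noteq> - u" "x \<noteq> - v" "u \<noteq> - v"
    and dep: "x + q *\<^sub>R u + r *\<^sub>R v = 0" "q \<ge> 0" "r \<ge> 0"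
    and sum: "N (x + u + v) \<ge> 1"
  shows "inner f x = 1 \<or> inner f x = -1"
proof -
  consider "opposite_inside x u v" | "opposite_inside u x v" | "opposite_inside v x u"
    using positive_dependence[of x u v 1 q r] assms by auto
  then show ?thesis
  proof cases
    case 1
    obtain g where g: "inner g u = 1" "inner g v = 1" "\<And>y. \<bar>inner g y\<bar> \<le> N y"
      using opposite_inside_support[OF 1] unit by blast
    obtain t where t: "0 < t" "t < 1" "- u = t *\<^sub>R v + (1 - t) *\<^sub>R w"
      using uvw unfolding opposite_inside_def by blast
    have "inner g (- u) = t + (1 - t) * inner g w"
      unfolding t(3) by (simp add: inner_add_right g)
    then have "(1 - t) * (1 + inner g w) = - 2 * t" using g by (simp add: algebra_simps)
    moreover have "0 \<le> (1 - t) * (1 + inner g w)" using g(3)[of w] t unit by simp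
    ultimately show ?thesis using t by linarith
  next
    case 2
    then obtain t where t: "0 < t" "- u = t *\<^sub>R x + (1 - t) *\<^sub>R v"
      unfolding opposite_inside_def by blast
    have "inner f (- u) = t * inner f x + (1 - t)"
      unfolding t(2) by (simp add: inner_add_right f)
    then have "t * inner f x = t" using f by simp
    then show ?thesis using t by simp
  next
    case 3
    then obtain t where t: "0 < t" "- v = t *\<^sub>R x + (1 - t) *\<^sub>R u"
      unfolding opposite_inside_def by blast
    have "inner f (- v) = t * inner f x - (1 - t)"
      unfolding t(2) by (simp add: inner_add_right f)
    then have "t * inner f x = - t" using f by simp
    then show ?thesis using t by (metis less_irrefl minus_mult_right mult.right_neutral mult_left_cancel)
  qed
qed

end

section \<open>Cones in the plane\<close>

text \<open>Vectors of the open half-plane \<open>a \<bullet> x > 0\<close> are ordered by angle through the slope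
  \<open>(a\<^sub>1x\<^sub>2 - a\<^sub>2x\<^sub>1) / (a \<bullet> x)\<close>, which is, up to the factor
  \<open>\<bar>a\<bar>\<close>, the position at which the ray of \<open>x\<close> meets the line \<open>a \<bullet> y = 1\<close>.\<close>

definition slope :: "real ^ 2 \<Rightarrow> real ^ 2 \<Rightarrow> real" where
  "slope a x = (a $ 1 * x $ 2 - a $ 2 * x $ 1) / inner a x"

lemma in_cone_if_slope_between:
  fixes a x y m :: "real ^ 2"
  assumes pos: "inner a x > 0" "inner a y > 0" "inner a m > 0"
    and between: "slope a x \<le> slope a m" "slope a m \<le> slope a y"
  shows "\<exists>p q. p \<ge> 0 \<and> q \<ge> 0 \<and> m = p *\<^sub>R x + q *\<^sub>R y"
proof -
  define h where "h z = a $ 1 * z $ 2 - a $ 2 * z $ 1" for z :: "real ^ 2"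
  have a: "a \<noteq> 0" using pos by auto
  have ip: "inner a z = a $ 1 * z $ 1 + a $ 2 * z $ 2" for z
    by (simp add: inner_vec_def sum_2)
  have coord: "z = w" if "inner a z = inner a w" "h z = h w" for z w
  proof -
    define d where "d = z - w"
    have e: "a $ 1 * d $ 1 + a $ 2 * d $ 2 = 0" "a $ 1 * d $ 2 - a $ 2 * d $ 1 = 0"
      using that by (simp_all add: ip h_def d_def algebra_simps)
    have a2: "(a $ 1)\<^sup>2 + (a $ 2)\<^sup>2 \<noteq> 0" using a by (auto simp: vec_eq_iff forall_2 sum_power2_eq_zero_iff)
    have "((a $ 1)\<^sup>2 + (a $ 2)\<^sup>2) * d $ 1 = 0" "((a $ 1)\<^sup>2 + (a $ 2)\<^sup>2) * d $ 2 = 0"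
      using e by algebra+
    then have "d = 0" using a2 by (auto simp: vec_eq_iff forall_2)
    then show ?thesis by (simp add: d_def)
  qed
  have h_comb: "h (p *\<^sub>R x + q *\<^sub>R y) = p * h x + q * h y" for p q
    by (simp add: h_def algebra_simps)
  have hs: "h z = slope a z * inner a z" if "inner a z > 0" for z
    using that by (simp add: slope_def h_def)
  obtain t where t: "0 \<le> t" "t \<le> 1" "slope a m = (1 - t) * slope a x + t * slope a y"
  proof (cases "slope a x = slope a y")
    case True
    then show ?thesis using that[of 0] between by simp
  next
    case False
    then have "slope a m \<in> closed_segment (slope a x) (slope a y)"
      using between by (simp add: closed_segment_eq_real_ivl)
    then show ?thesis using that by (auto simp: in_segment)
  qed
  define p q where "p = (1 - t) * inner a m / inner a x" and "q = t * inner a m / inner a y"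
  have "p \<ge> 0" "q \<ge> 0" using t pos by (auto simp: p_def q_def)
  moreover have "m = p *\<^sub>R x + q *\<^sub>R y"
  proof (rule coord)
    show "inner a m = inner a (p *\<^sub>R x + q *\<^sub>R y)"
      using pos by (simp add: inner_add_right p_def q_def) (simp add: field_simps)
    have "p * h x + q * h y = ((1 - t) * slope a x + t * slope a y) * inner a m"
      using pos by (simp add: hs p_def q_def) (simp add: field_simps)
    then show "h m = h (p *\<^sub>R x + q *\<^sub>R y)" using t(3) hs[OF pos(3)] by (simp add: h_comb)
  qed
  ultimately show ?thesis by blast
qed

text \<open>The line \<open>f = 1\<close> misses the origin, so it meets every line through the origin at most once:
  \<open>v\<close> and \<open>w\<close> are linearly independent.\<close>

lemma basis_on_level_line:
  fixes v w x f :: "real ^ 2"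
  assumes "inner f v = 1" "inner f w = 1" "v \<noteq> w"
  shows "\<exists>p q. x = p *\<^sub>R v + q *\<^sub>R w"
proof -
  define d where "d = v $ 1 * w $ 2 - v $ 2 * w $ 1"
  have fv: "f $ 1 * v $ 1 + f $ 2 * v $ 2 = 1" "f $ 1 * w $ 1 + f $ 2 * w $ 2 = 1"
    using assms by (simp_all add: inner_vec_def sum_2)
  have "d \<noteq> 0"
  proof
    assume "d = 0"
    then have "v $ 1 = w $ 1" "v $ 2 = w $ 2" using fv unfolding d_def by algebra+
    then show False using assms(3) by (simp add: vec_eq_iff forall_2)
  qed
  then show ?thesis
    by (intro exI[of _ "(x $ 1 * w $ 2 - x $ 2 * w $ 1) / d"]
          exI[of _ "(v $ 1 * x $ 2 - v $ 2 * x $ 1) / d"])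
      (simp add: vec_eq_iff forall_2 field_simps, simp add: d_def algebra_simps)
qed

text \<open>The cones spanned by any two of \<open>u, v, w\<close> cover the plane when \<open>0\<close> is inside their triangle;
  here they cover \<open>-x\<close>.\<close>

lemma dependent_with_two_of_triple:
  fixes u v w x f :: "real ^ 2"
  assumes uvw: "opposite_inside u v w"
    and f: "inner f v = 1" "inner f w = 1" and "v \<noteq> w"
  shows "\<exists>q r. q \<ge> 0 \<and> r \<ge> 0 \<and>
    (x + q *\<^sub>R v + r *\<^sub>R w = 0 \<or> x + q *\<^sub>R u + r *\<^sub>R v = 0 \<or> x + q *\<^sub>R u + r *\<^sub>R w = 0)"
proof -
  obtain t where t: "0 < t" "t < 1" "- u = t *\<^sub>R v + (1 - t) *\<^sub>R w"
    using uvw unfolding opposite_inside_def by blast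
  have u: "u = - (t *\<^sub>R v + (1 - t) *\<^sub>R w)" using t(3) by (metis minus_minus)
  obtain p q where pq: "x = p *\<^sub>R v + q *\<^sub>R w" using basis_on_level_line[OF f \<open>v \<noteq> w\<close>] by blast
  (* Adding a multiple of the dependence among u, v, w removes the coefficient of v or of w. *)
  have "x + c *\<^sub>R u + (c * (1 - t) - q) *\<^sub>R w = 0" if "c * t = p" for c
    by (simp add: pq u that[symmetric] algebra_simps)
  from this[of "p / t"]
  have elim_v: "x + (p / t) *\<^sub>R u + (p * (1 - t) / t - q) *\<^sub>R w = 0"
    using t(1) by simp
  have "x + c *\<^sub>R u + (c * t - p) *\<^sub>R v = 0" if "c * (1 - t) = q" for c
    by (simp add: pq u that[symmetric] algebra_simps)
  from this[of "q / (1 - t)"]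
  have elim_w: "x + (q / (1 - t)) *\<^sub>R u + (q * t / (1 - t) - p) *\<^sub>R v = 0"
    using t(2) by simp
  consider "p \<le> 0" "q \<le> 0" | "p \<ge> 0" "q * t \<le> p * (1 - t)" | "q \<ge> 0" "p * (1 - t) \<le> q * t"
  proof -
    have "q * t \<le> p * (1 - t)" if "p \<ge> 0" "q \<le> 0"
      using that t by (meson diff_ge_0_iff_ge less_imp_le mult_nonneg_nonneg mult_nonpos_nonneg order_trans)
    moreover have "p * (1 - t) \<le> q * t" if "p \<le> 0" "q \<ge> 0"
      using that t by (meson diff_ge_0_iff_ge less_imp_le mult_nonneg_nonneg mult_nonpos_nonneg order_trans)
    ultimately show thesis using that by linarith
  qed
  then show ?thesis
  proof cases
    case 1
    have "x + (- p) *\<^sub>R v + (- q) *\<^sub>R w = 0" by (simp add: pq)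
    then show ?thesis using 1 by (intro exI[of _ "- p"] exI[of _ "- q"]) simp
  next
    case 2
    then have "p / t \<ge> 0" "p * (1 - t) / t - q \<ge> 0" using t by (simp_all add: field_simps)
    then show ?thesis using elim_v by blast
  next
    case 3
    then have "q / (1 - t) \<ge> 0" "q * t / (1 - t) - p \<ge> 0" using t by (simp_all add: field_simps)
    then show ?thesis using elim_w by blast
  qed
qed

section \<open>Families whose triple sums are large\<close>

context
  fixes N :: "real ^ 2 \<Rightarrow> real"
  assumes norm_N: "is_norm N"
begin

text \<open>Some two of \<open>u, v, w\<close> are positively dependent with \<open>x\<close>. If \<open>u\<close> is one of them, the triple
  has a member on each of the two lines \<open>f = 1\<close> and \<open>f = -1\<close>, which was treated above. For \<open>x, v, w\<close>
  the functional \<open>f\<close> itself shows that only the antipode of \<open>x\<close> can be inside a segment.\<close>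

lemma level_of_other_vector:
  assumes unit: "N u = 1" "N v = 1" "N w = 1" "N x = 1"
    and uvw: "opposite_inside u v w"
    and f: "inner f u = -1" "inner f v = 1" "inner f w = 1" "\<And>y. \<bar>inner f y\<bar> \<le> N y"
    and no_antipodes: "x \<noteq> - u" "x \<noteq> - v" "x \<noteq> - w" "u \<noteq> - v" "u \<noteq> - w" "v \<noteq> - w"
    and sums: "N (x + u + v) \<ge> 1" "N (x + u + w) \<ge> 1" "N (x + v + w) \<ge> 1"
  shows "inner f x = 1 \<or> inner f x = -1"
proof -
  have "v \<noteq> w"
  proof
    assume "v = w"
    then have "- u = v" using uvw by (auto simp: opposite_inside_def scaleR_left_distrib[symmetric])
    then show False using no_antipodes(4) by auto
  qed
  then obtain q r where qr: "q \<ge> 0" "r \<ge> 0"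
    and "x + q *\<^sub>R v + r *\<^sub>R w = 0 \<or> x + q *\<^sub>R u + r *\<^sub>R v = 0 \<or> x + q *\<^sub>R u + r *\<^sub>R w = 0"
    using dependent_with_two_of_triple[OF uvw f(2,3)] by blast
  then consider "x + q *\<^sub>R v + r *\<^sub>R w = 0" | "x + q *\<^sub>R u + r *\<^sub>R v = 0" | "x + q *\<^sub>R u + r *\<^sub>R w = 0"
    by blast
  then show ?thesis
  proof cases
    case 1
    have fx: "inner f x \<ge> -1" using f(4)[of x] unit by simp
    (* The antipode of v, or of w, is on the line f = -1, the lowest one that meets the ball, and so
       cannot be inside a segment of the ball one end of which is on the line f = 1. *)
    have no: "\<not> opposite_inside y x z" if "inner f y = 1" "inner f z = 1" for y z
    proof
      assume "opposite_inside y x z"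
      then obtain t where t: "0 < t" "t < 1" "- y = t *\<^sub>R x + (1 - t) *\<^sub>R z"
        unfolding opposite_inside_def by blast
      have "inner f (- y) = t * inner f x + (1 - t)"
        unfolding t(3) by (simp add: inner_add_right that)
      then have "t * (inner f x + 1) = 2 * t - 2" using that by (simp add: algebra_simps)
      moreover have "0 \<le> t * (inner f x + 1)" using t fx by simp
      ultimately show False using t by linarith
    qed
    have "opposite_inside x v w"
      using positive_dependence[OF norm_N, of x v w 1 q r] 1 qr unit no_antipodes sums(3) no f by auto
    then obtain t where t: "- x = t *\<^sub>R v + (1 - t) *\<^sub>R w" unfolding opposite_inside_def by blast
    have "inner f (- x) = 1" unfolding t by (simp add: inner_add_right f)
    then show ?thesis by simp
  next
    case 2
    show ?thesis
      by (rule level_if_dependent_with_opposite[OF norm_N unit(1,2,3,4) uvw f(1,2) _ _ _ 2 qr])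
        (use no_antipodes sums in auto)
  next
    case 3
    show ?thesis
      by (rule level_if_dependent_with_opposite[OF norm_N unit(1,3,2,4)
            opposite_inside_swap[OF uvw] f(1,3) _ _ _ 3 qr])
        (use no_antipodes sums in auto)
  qed
qed

lemma odd_half_plane_sum_ge_1:
  assumes A: "finite A" "odd (card A)" and unit: "\<And>i. i \<in> A \<Longrightarrow> N (v i) = 1"
    and pos: "\<And>i. i \<in> A \<Longrightarrow> inner a (v i) > 0"
  shows "N (sum v A) \<ge> 1"
proof -
  obtain m where m: "m \<in> A" and pairs: "\<And>g :: _ \<Rightarrow> real.
      (\<forall>i\<in>A. \<forall>j\<in>A. slope a (v i) \<le> slope a (v m) \<longrightarrow> slope a (v m) \<le> slope a (v j) \<longrightarrow> 0 \<le> g i + g j)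
      \<Longrightarrow> 0 \<le> sum g (A - {m})"
    using median_pairing[OF A, of "\<lambda>i. slope a (v i)"] by blast
  obtain f where f: "inner f (v m) = 1" "\<And>x. \<bar>inner f x\<bar> \<le> N x"
    using ex_support_functional[OF norm_N, of "v m"] unit m by blast
  have "0 \<le> inner f (v i) + inner f (v j)"
    if ij: "i \<in> A" "j \<in> A" "slope a (v i) \<le> slope a (v m)" "slope a (v m) \<le> slope a (v j)" for i j
  proof -
    obtain p q where "p \<ge> 0" "q \<ge> 0" "v m = p *\<^sub>R v i + q *\<^sub>R v j"
      using in_cone_if_slope_between[of a "v i" "v j" "v m"] pos m ij by blast
    then show ?thesis
      using support_at_between_nonneg[OF norm_N, of "v i" "v j" "v m" p q f] unit m ij f by blast
  qed
  then have "0 \<le> (\<Sum>i\<in>A - {m}. inner f (v i))" by (intro pairs) blast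
  then have "1 \<le> (\<Sum>i\<in>A. inner f (v i))" using sum.remove[OF A(1) m, of "\<lambda>i. inner f (v i)"] f by simp
  then have "1 \<le> inner f (sum v A)" by (simp add: inner_sum_right)
  then show ?thesis using f(2)[of "sum v A"] by linarith
qed

lemma odd_surrounding_sum_ge_1:
  assumes A: "finite A" "odd (card A)" and unit: "\<And>i. i \<in> A \<Longrightarrow> N (v i) = 1"
    and triple: "\<And>i j k. i \<in> A \<Longrightarrow> j \<in> A \<Longrightarrow> k \<in> A \<Longrightarrow> i \<noteq> j \<Longrightarrow> j \<noteq> k \<Longrightarrow> i \<noteq> k
      \<Longrightarrow> N (v i + v j + v k) \<ge> 1"
    and no_antipodes: "\<And>i j. i \<in> A \<Longrightarrow> j \<in> A \<Longrightarrow> v i \<noteq> - v j"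
    and ijk: "i \<in> A" "j \<in> A" "k \<in> A" "i \<noteq> j" "j \<noteq> k" "i \<noteq> k"
    and opp: "opposite_inside (v i) (v j) (v k)"
  shows "N (sum v A) \<ge> 1"
proof -
  obtain f where f: "inner f (v i) = -1" "inner f (v j) = 1" "inner f (v k) = 1"
    "\<And>x. \<bar>inner f x\<bar> \<le> N x"
    using opposite_inside_support[OF norm_N opp] unit ijk by blast
  have "inner f (v l) = 1 \<or> inner f (v l) = -1" if l: "l \<in> A" for l
  proof (cases "l \<in> {i, j, k}")
    case True
    then show ?thesis using f by auto
  next
    case False
    show ?thesis
      by (rule level_of_other_vector[of "v i" "v j" "v k", OF _ _ _ _ opp f])
        (use False l ijk unit triple no_antipodes in auto)
  qed
  then have "1 \<le> \<bar>\<Sum>l\<in>A. inner f (v l)\<bar>" by (intro abs_sum_signs_ge_1 A) auto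
  then have "1 \<le> \<bar>inner f (sum v A)\<bar>" by (simp add: inner_sum_right)
  then show ?thesis using f(4)[of "sum v A"] by linarith
qed

text \<open>Either the family is in an open half-plane, by separation, or Caratheodory provides at most
  three of its vectors with \<open>0\<close> in their convex hull. Fewer than three would mean a zero vector
  or an antipodal pair.\<close>

lemma half_plane_or_opposite_inside:
  assumes A: "finite A" and unit: "\<And>i. i \<in> A \<Longrightarrow> N (v i) = 1"
    and triple: "\<And>i j k. i \<in> A \<Longrightarrow> j \<in> A \<Longrightarrow> k \<in> A \<Longrightarrow> i \<noteq> j \<Longrightarrow> j \<noteq> k \<Longrightarrow> i \<noteq> k
      \<Longrightarrow> N (v i + v j + v k) \<ge> 1"
    and no_antipodes: "\<And>i j. i \<in> A \<Longrightarrow> j \<in> A \<Longrightarrow> v i \<noteq> - v j"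
  shows "(\<exists>a. \<forall>i\<in>A. inner a (v i) > 0) \<or>
    (\<exists>i\<in>A. \<exists>j\<in>A. \<exists>k\<in>A. i \<noteq> j \<and> j \<noteq> k \<and> i \<noteq> k \<and> opposite_inside (v i) (v j) (v k))"
proof (cases "0 \<in> convex hull (v ` A)")
  case False
  have "closed (convex hull (v ` A))"
    using A by (intro compact_imp_closed compact_convex_hull finite_imp_compact) simp
  then obtain a b where "0 < b" "\<forall>x\<in>convex hull (v ` A). inner a x > b"
    using separating_hyperplane_closed_0[OF convex_convex_hull _ False] by blast
  then have "\<forall>i\<in>A. inner a (v i) > 0" by (meson hull_inc imageI order_less_trans)
  then show ?thesis by blast
next
  case True
  then obtain S c where S: "finite S" "S \<subseteq> v ` A" "card S \<le> 3" and c: "\<forall>x\<in>S. 0 \<le> c x" "sum c S = 1"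
    and comb: "(\<Sum>x\<in>S. c x *\<^sub>R x) = 0"
    unfolding convex_hull_caratheodory[of "v ` A"] by auto
  have unitS: "N x = 1" if "x \<in> S" for x using S(2) that unit by auto
  have antiS: "x \<noteq> - y" if xyS: "x \<in> S" "y \<in> S" for x y
  proof -
    obtain i j where "i \<in> A" "x = v i" "j \<in> A" "y = v j" using S(2) xyS by blast
    then show ?thesis using no_antipodes[of i j] by simp
  qed
  have "card S \<noteq> 0" using S c by auto
  moreover have "card S \<noteq> 1"
  proof
    assume "card S = 1"
    then obtain x where x: "S = {x}" by (auto simp: card_1_singleton_iff)
    then have "x = 0" using c comb by simp
    then show False using antiS[of x x] x by simp
  qed
  moreover have "card S \<noteq> 2"
  proof
    assume "card S = 2"
    then obtain x y where xy: "S = {x, y}" "x \<noteq> y" by (auto simp: card_2_iff)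
    then have "x = - y"
      using antipodal_if_dependent[OF norm_N, of x y "c x" "c y"] c comb unitS by auto
    then show False using antiS[of x y] xy by simp
  qed
  ultimately have "card S = 3" using S(3) by linarith
  then obtain x y z where xyz: "S = {x, y, z}" "x \<noteq> y" "y \<noteq> z" "x \<noteq> z" by (auto simp: card_3_iff)
  then obtain i j k where ijk: "i \<in> A" "x = v i" "j \<in> A" "y = v j" "k \<in> A" "z = v k"
    using S(2) by auto
  then have distinct: "i \<noteq> j" "j \<noteq> k" "i \<noteq> k" using xyz by auto
  have dep: "c x *\<^sub>R x + c y *\<^sub>R y + c z *\<^sub>R z = 0" and "c x + c y + c z = 1"
    using comb c xyz by (auto simp: add.assoc)
  then have nz: "c x \<noteq> 0 \<or> c y \<noteq> 0 \<or> c z \<noteq> 0" by auto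
  have "N (x + y + z) \<ge> 1" using triple[of i j k] ijk distinct by simp
  then have "opposite_inside x y z \<or> opposite_inside y x z \<or> opposite_inside z x y"
    by (intro positive_dependence[OF norm_N _ _ _ _ _ _ dep _ _ _ nz])
      (use unitS antiS c(1) xyz(1) in simp_all)
  then show ?thesis using ijk distinct by metis
qed

lemma odd_family_sum_ge_1:
  assumes "finite A" "odd (card A)" "\<And>i. i \<in> A \<Longrightarrow> N (v i) = 1"
    and "\<And>i j k. i \<in> A \<Longrightarrow> j \<in> A \<Longrightarrow> k \<in> A \<Longrightarrow> i \<noteq> j \<Longrightarrow> j \<noteq> k \<Longrightarrow> i \<noteq> k
      \<Longrightarrow> N (v i + v j + v k) \<ge> 1"
  shows "N (sum v A) \<ge> 1"
  using assms
proof (induction "card A" arbitrary: A rule: less_induct)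
  case less
  show ?case
  proof (cases "\<exists>i\<in>A. \<exists>j\<in>A. v i = - v j")
    case True
    then obtain i j where ij: "i \<in> A" "j \<in> A" "v i = - v j" by blast
    have "i \<noteq> j"
    proof
      assume "i = j"
      then have "2 *\<^sub>R v i = 0" using ij(3) by (metis add.left_inverse scaleR_2)
      then have "v i = 0" by simp
      then show False using less.prems(3)[OF ij(1)] N_eq_0[OF norm_N, of "v i"] by simp
    qed
    define B where "B = A - {i} - {j}"
    have A: "A = insert i (insert j B)" "i \<notin> B" "j \<notin> B" "finite B"
      using ij less.prems(1) by (auto simp: B_def)
    then have "card A = Suc (Suc (card B))" using \<open>i \<noteq> j\<close> by simp
    then have "card B < card A" "odd (card B)" using less.prems(2) by auto
    then have "N (sum v B) \<ge> 1" using A less.prems(3,4) by (intro less.hyps) auto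
    moreover have "sum v A = sum v B" using A \<open>i \<noteq> j\<close> ij(3) by simp
    ultimately show ?thesis by simp
  next
    case False
    then have no: "\<And>i j. i \<in> A \<Longrightarrow> j \<in> A \<Longrightarrow> v i \<noteq> - v j" by blast
    have "(\<exists>a. \<forall>i\<in>A. inner a (v i) > 0) \<or>
        (\<exists>i\<in>A. \<exists>j\<in>A. \<exists>k\<in>A. i \<noteq> j \<and> j \<noteq> k \<and> i \<noteq> k \<and> opposite_inside (v i) (v j) (v k))"
      by (rule half_plane_or_opposite_inside) (use less.prems no in auto)
    then show ?thesis
    proof (elim disjE exE bexE conjE)
      fix a assume "\<forall>i\<in>A. inner a (v i) > 0"
      then show ?thesis using less.prems by (intro odd_half_plane_sum_ge_1[of A v a]) auto
    next
      fix i j k assume "i \<in> A" "j \<in> A" "k \<in> A" "i \<noteq> j" "j \<noteq> k" "i \<noteq> k"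
        "opposite_inside (v i) (v j) (v k)"
      then show ?thesis
        using less.prems no by (intro odd_surrounding_sum_ge_1[of A v i j k]) auto
    qed
  qed
qed

end

theorem theorem2:
  fixes N :: "real ^ 2 \<Rightarrow> real"
    and n :: nat
    and v :: "nat \<Rightarrow> real ^ 2"
  assumes "is_norm N"
    and "n \<ge> 3"
    and "odd n"
    and "\<And>i. i \<in> {1..n} \<Longrightarrow> N (v i) = 1"
    and "\<And>i j k. i \<in> {1..n} \<Longrightarrow> j \<in> {1..n} \<Longrightarrow> k \<in> {1..n} \<Longrightarrow>
           i \<noteq> j \<Longrightarrow> j \<noteq> k \<Longrightarrow> i \<noteq> k \<Longrightarrow> N (v i + v j + v k) \<ge> 1"
  shows "N (\<Sum>i = 1..n. v i) \<ge> 1"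
  using assms(3) by (intro odd_family_sum_ge_1[OF assms(1)] assms(4,5)) auto

end
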